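(* For $(M^0,M^1)\in\mathcal M(\theta_0,\theta_1,\theta_\infty)$ let $x_0=m^0_{11}$, $x_1=m^1_{11}$, $x_2=\mathrm{tr}(M^1M^0)$, let $M^j_{(1)}=M^1M^0\,M^j\,(M^1M^0)^{-1}=(m^j_{(1),kl})$ for $j=0,1$, and write $x_0^{(1)}=m^0_{(1),11}$, $x_1^{(1)}=m^1_{(1),11}$, $x_2^{(1)}=\mathrm{tr}(M^1_{(1)}M^0_{(1)})$. Then $(x_0^{(1)},x_1^{(1)},x_2^{(1)})\in\mathbf V_{(\theta_0,\theta_1,\theta_\infty)}$, and $$x_0^{(1)}=-x_1x_2-x_0+\mathrm{tr}M^0+e^{-\pi i\theta_\infty}\mathrm{tr}M^1,$$ $$x_1^{(1)}=x_1x_2^2+x_0x_2-x_1-(\mathrm{tr}M^0+e^{-\pi i\theta_\infty}\mathrm{tr}M^1)x_2+\mathrm{tr}M^1+e^{-\pi i\theta_\infty}\mathrm{tr}M^0,$$ $$x_2^{(1)}=x_2.$$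
   Context: $\theta_0,\theta_1,\theta_\infty\in\mathbb{C}$; $\sigma_3=\mathrm{diag}(1,-1)$. $\mathcal M(\theta_0,\theta_1,\theta_\infty)$ is the set of pairs $(M^0,M^1)\in SL_2(\mathbb{C})^2$, $M^0=(m^0_{kl})$, $M^1=(m^1_{kl})$, satisfying $m^0_{11}m^1_{11}+m^0_{21}m^1_{12}=e^{-\pi i\theta_\infty}$, $\mathrm{tr}M^0=2\cos\pi\theta_0$, $\mathrm{tr}M^1=2\cos\pi\theta_1$, modulo $(M^0,M^1)\sim c^{\sigma_3}(M^0,M^1)c^{-\sigma_3}$, $c\in\mathbb{C}\setminus\{0\}$. The character variety is $$\mathbf V_{(\theta_0,\theta_1,\theta_\infty)}:\ x_0x_1x_2+x_0^2+x_1^2-\mu_0x_0-\mu_1x_1-e^{-\pi i\theta_\infty}x_2+\kappa=0,$$ where, with $T_0=2\cos\pi\theta_0$ $(=\mathrm{tr}M^0)$, $T_1=2\cos\pi\theta_1$ $(=\mathrm{tr}M^1)$, $\mu_0=T_0+e^{-\pi i\theta_\infty}T_1$, $\mu_1=T_1+e^{-\pi i\theta_\infty}T_0$, $\kappa=e^{-2\pi i\theta_\infty}+e^{-\pi i\theta_\infty}T_0T_1+1$. *)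

theory Defs
  imports "HOL-Analysis.Analysis"
begin

definition SL2 :: "(complex^2^2) set" where
  "SL2 = {A. det A = 1}"

text \<open>\<^term>\<open>sigma3_pow c k\<close> is the matrix \<open>c\<close> to the power \<open>k \<sigma>\<^sub>3\<close>,
  where \<open>\<sigma>\<^sub>3 = diag(1, -1)\<close>, i.e. the matrix \<open>diag(c\<^sup>k, c\<^sup>-\<^sup>k)\<close>.\<close>

definition sigma3_pow :: "complex \<Rightarrow> int \<Rightarrow> complex^2^2" where
  "sigma3_pow c k = vector [vector [c powi k, 0], vector [0, c powi (- k)]]"

definition monodromy_pairs ::
    "complex \<Rightarrow> complex \<Rightarrow> complex \<Rightarrow> ((complex^2^2) \<times> (complex^2^2)) set" where
  "monodromy_pairs \<theta>0 \<theta>1 \<theta>inf =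
     {(M0, M1). M0 \<in> SL2 \<and> M1 \<in> SL2 \<and>
        M0 $ 1 $ 1 * M1 $ 1 $ 1 + M0 $ 2 $ 1 * M1 $ 1 $ 2 = exp (- (of_real pi * \<i> * \<theta>inf)) \<and>
        trace M0 = 2 * cos (of_real pi * \<theta>0) \<and>
        trace M1 = 2 * cos (of_real pi * \<theta>1)}"

definition monodromy_rel ::
    "complex \<Rightarrow> complex \<Rightarrow> complex \<Rightarrow>
      (((complex^2^2) \<times> (complex^2^2)) \<times> ((complex^2^2) \<times> (complex^2^2))) set" where
  "monodromy_rel \<theta>0 \<theta>1 \<theta>inf =
     {((M0, M1), (N0, N1)).
        (M0, M1) \<in> monodromy_pairs \<theta>0 \<theta>1 \<theta>inf \<and> (N0, N1) \<in> monodromy_pairs \<theta>0 \<theta>1 \<theta>inf \<and>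
        (\<exists>c. c \<noteq> 0 \<and> N0 = sigma3_pow c 1 ** M0 ** sigma3_pow c (- 1)
                  \<and> N1 = sigma3_pow c 1 ** M1 ** sigma3_pow c (- 1))}"

definition monodromy_manifold ::
    "complex \<Rightarrow> complex \<Rightarrow> complex \<Rightarrow> ((complex^2^2) \<times> (complex^2^2)) set set" where
  "monodromy_manifold \<theta>0 \<theta>1 \<theta>inf = monodromy_pairs \<theta>0 \<theta>1 \<theta>inf // monodromy_rel \<theta>0 \<theta>1 \<theta>inf"

definition character_variety ::
    "complex \<Rightarrow> complex \<Rightarrow> complex \<Rightarrow> (complex \<times> complex \<times> complex) set" where
  "character_variety \<theta>0 \<theta>1 \<theta>inf =
     (let T0 = 2 * cos (of_real pi * \<theta>0);
          T1 = 2 * cos (of_real pi * \<theta>1);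
          e = exp (- (of_real pi * \<i> * \<theta>inf));
          \<mu>0 = T0 + e * T1;
          \<mu>1 = T1 + e * T0;
          \<kappa> = exp (- (2 * of_real pi * \<i> * \<theta>inf)) + e * T0 * T1 + 1
      in {(x0, x1, x2).
            x0 * x1 * x2 + x0\<^sup>2 + x1\<^sup>2 - \<mu>0 * x0 - \<mu>1 * x1 - e * x2 + \<kappa> = 0})"

lemma sigma3_pow_conj:
  assumes "c \<noteq> 0"
  shows "(sigma3_pow c 1 ** M ** sigma3_pow c (- 1)) $ 1 $ 1 = M $ 1 $ 1"
    and "(sigma3_pow c 1 ** M ** sigma3_pow c (- 1)) $ 1 $ 2 = c\<^sup>2 * M $ 1 $ 2"
    and "(sigma3_pow c 1 ** M ** sigma3_pow c (- 1)) $ 2 $ 1 = M $ 2 $ 1 / c\<^sup>2"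
    and "(sigma3_pow c 1 ** M ** sigma3_pow c (- 1)) $ 2 $ 2 = M $ 2 $ 2"
  using assms
  by (simp_all add: sigma3_pow_def matrix_matrix_mult_def sum_2 power_int_minus
        power2_eq_square field_simps)

lemma sigma3_pow_conj_iff:
  assumes "c \<noteq> 0"
  shows "N = sigma3_pow c 1 ** M ** sigma3_pow c (- 1) \<longleftrightarrow>
    N $ 1 $ 1 = M $ 1 $ 1 \<and> N $ 1 $ 2 = c\<^sup>2 * M $ 1 $ 2 \<and>
    N $ 2 $ 1 = M $ 2 $ 1 / c\<^sup>2 \<and> N $ 2 $ 2 = M $ 2 $ 2"
  by (auto simp: vec_eq_iff forall_2 sigma3_pow_conj[OF assms])

lemma equiv_monodromy_rel:
  "equiv (monodromy_pairs \<theta>0 \<theta>1 \<theta>inf) (monodromy_rel \<theta>0 \<theta>1 \<theta>inf)"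
proof (rule equivI)
  show "monodromy_rel \<theta>0 \<theta>1 \<theta>inf \<subseteq> monodromy_pairs \<theta>0 \<theta>1 \<theta>inf \<times> monodromy_pairs \<theta>0 \<theta>1 \<theta>inf"
    by (auto simp: monodromy_rel_def)
  show "refl_on (monodromy_pairs \<theta>0 \<theta>1 \<theta>inf) (monodromy_rel \<theta>0 \<theta>1 \<theta>inf)"
    by (auto simp: refl_on_def monodromy_rel_def sigma3_pow_conj_iff intro!: exI[of _ 1])
  show "sym (monodromy_rel \<theta>0 \<theta>1 \<theta>inf)"
  proof (rule symI, clarify)
    fix M0 M1 N0 N1
    assume *: "((M0, M1), (N0, N1)) \<in> monodromy_rel \<theta>0 \<theta>1 \<theta>inf"
    then obtain c where "c \<noteq> 0" "N0 = sigma3_pow c 1 ** M0 ** sigma3_pow c (- 1)"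
      "N1 = sigma3_pow c 1 ** M1 ** sigma3_pow c (- 1)"
      by (auto simp: monodromy_rel_def)
    then have "inverse c \<noteq> 0"
      "M0 = sigma3_pow (inverse c) 1 ** N0 ** sigma3_pow (inverse c) (- 1)"
      "M1 = sigma3_pow (inverse c) 1 ** N1 ** sigma3_pow (inverse c) (- 1)"
      by (simp_all add: sigma3_pow_conj_iff sigma3_pow_conj field_simps)
    with * show "((N0, N1), (M0, M1)) \<in> monodromy_rel \<theta>0 \<theta>1 \<theta>inf"
      unfolding monodromy_rel_def mem_Collect_eq prod.case by blast
  qed
  show "trans (monodromy_rel \<theta>0 \<theta>1 \<theta>inf)"
  proof (rule transI, clarify)
    fix L0 L1 M0 M1 N0 N1
    assume *: "((L0, L1), (M0, M1)) \<in> monodromy_rel \<theta>0 \<theta>1 \<theta>inf"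
      "((M0, M1), (N0, N1)) \<in> monodromy_rel \<theta>0 \<theta>1 \<theta>inf"
    from *(1) obtain c where "c \<noteq> 0" "M0 = sigma3_pow c 1 ** L0 ** sigma3_pow c (- 1)"
      "M1 = sigma3_pow c 1 ** L1 ** sigma3_pow c (- 1)"
      by (auto simp: monodromy_rel_def)
    moreover from *(2) obtain d where "d \<noteq> 0" "N0 = sigma3_pow d 1 ** M0 ** sigma3_pow d (- 1)"
      "N1 = sigma3_pow d 1 ** M1 ** sigma3_pow d (- 1)"
      by (auto simp: monodromy_rel_def)
    ultimately have "d * c \<noteq> 0"
      "N0 = sigma3_pow (d * c) 1 ** L0 ** sigma3_pow (d * c) (- 1)"
      "N1 = sigma3_pow (d * c) 1 ** L1 ** sigma3_pow (d * c) (- 1)"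
      by (simp_all add: sigma3_pow_conj_iff sigma3_pow_conj field_simps)
    with * show "((L0, L1), (N0, N1)) \<in> monodromy_rel \<theta>0 \<theta>1 \<theta>inf"
      unfolding monodromy_rel_def mem_Collect_eq prod.case by blast
  qed
qed

end

theory Submission
  imports Defs
begin

text \<open>
  The product \<open>P = M1 M0\<close> has upper left entry \<open>exp (- \<pi> \<i> \<theta>inf)\<close>, and it factors as
  \<open>P = N0 M1 = N1 N0\<close>. So the passage from \<open>(M0, M1)\<close> to \<open>(N0, N1)\<close> consists of two moves
  \<open>(A, B) \<mapsto> (B, B A B\<^sup>-\<^sup>1)\<close>, each preserving the product \<open>B A\<close>; by
  Cayley--Hamilton, \<open>A + B A B\<^sup>-\<^sup>1 = tr B \<cdot> B A - tr (B A) \<cdot> B + tr A\<close>, and the upper left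
  entry of this identity gives \<open>y0\<close> at the first move and \<open>y1\<close> at the second.
\<close>

lemma trace_2: "trace (A :: 'a::comm_semiring_1^2^2) = A $ 1 $ 1 + A $ 2 $ 2"
  by (simp add: trace_def sum_2)

lemma matrix_mult_2:
  fixes A B :: "'a::comm_semiring_1^2^2"
  shows "(A ** B) $ i $ j = A $ i $ 1 * B $ 1 $ j + A $ i $ 2 * B $ 2 $ j"
  by (simp add: matrix_matrix_mult_def sum_2)

lemma invertible_SL2: "A \<in> SL2 \<Longrightarrow> invertible A"
  by (simp add: SL2_def invertible_det_nz)

lemma SL2_mult: "A \<in> SL2 \<Longrightarrow> B \<in> SL2 \<Longrightarrow> A ** B \<in> SL2"
  by (simp add: SL2_def det_mul)

lemma invertible_matrix_inv:
  assumes "invertible A"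
  shows "A ** matrix_inv A = mat 1" and "matrix_inv A ** A = mat 1"
  using someI_ex[OF assms[unfolded invertible_def]] by (simp_all add: matrix_inv_def)

lemma invertible_matrix_mult_right_cancel:
  fixes A :: "'a::semiring_1^'n^'n"
  assumes "invertible A" and "X ** A = Y ** A"
  shows "X = Y"
  by (metis assms invertible_matrix_inv(1) matrix_mul_assoc matrix_mul_rid)

lemma conjugate_mult_right:
  fixes P :: "'a::semiring_1^'n^'n"
  assumes "invertible P"
  shows "(P ** A ** matrix_inv P) ** P = P ** A"
  by (metis assms invertible_matrix_inv(2) matrix_mul_assoc matrix_mul_rid)

lemma trace_conjugate:
  fixes P :: "'a::comm_semiring_1^'n^'n"
  assumes "invertible P"
  shows "trace (P ** A ** matrix_inv P) = trace A"
  by (metis assms invertible_matrix_inv(2) matrix_mul_assoc matrix_mul_lid trace_mul_sym)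

lemma det_conjugate:
  fixes P :: "'a::field^'n^'n"
  assumes "invertible P"
  shows "det (P ** A ** matrix_inv P) = det A"
  by (metis assms conjugate_mult_right det_mul invertible_det_nz mult.commute mult_right_cancel)

text \<open>With \<open>det B = 1\<close>, Cramer's rule on the first row of
  \<open>N ** B = B ** A\<close> gives \<open>N $ 1 $ 1\<close>. Stating the conjugation without an
  inverse lets both moves be instances.\<close>

lemma SL2_conjugate_entry:
  assumes "B \<in> SL2" and "N ** B = B ** A"
  shows "N $ 1 $ 1 = - B $ 1 $ 1 * trace (B ** A) - A $ 1 $ 1 + trace A
    + (B ** A) $ 1 $ 1 * trace B"
proof -
  have "N $ 1 $ 1 * B $ 1 $ 1 + N $ 1 $ 2 * B $ 2 $ 1 = (B ** A) $ 1 $ 1"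
    "N $ 1 $ 1 * B $ 1 $ 2 + N $ 1 $ 2 * B $ 2 $ 2 = (B ** A) $ 1 $ 2"
    by (simp_all flip: assms(2) add: matrix_mult_2)
  moreover have "B $ 1 $ 1 * B $ 2 $ 2 - B $ 1 $ 2 * B $ 2 $ 1 = 1"
    using assms(1) by (simp add: SL2_def det_2)
  ultimately show ?thesis
    unfolding matrix_mult_2 trace_2 by algebra
qed

text \<open>Put \<open>p = B $ 1 $ 2 * A $ 2 $ 1\<close> and
  \<open>q = B $ 2 $ 1 * A $ 1 $ 2\<close>, the off-diagonal contributions to the diagonal of
  \<open>B ** A\<close>. The determinants give \<open>p * q = (A $ 1 $ 1 * A $ 2 $ 2 - 1) * (B $ 1 $
  1 * B $ 2 $ 2 - 1)\<close>; expressing everything through the corner entries, the traces and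
  \<open>e\<close> turns this into the cubic.\<close>

lemma SL2_character_equation:
  assumes "A \<in> SL2" and "B \<in> SL2" and "(B ** A) $ 1 $ 1 = e"
  shows "A $ 1 $ 1 * B $ 1 $ 1 * trace (B ** A) + (A $ 1 $ 1)\<^sup>2 + (B $ 1 $ 1)\<^sup>2
    - (trace A + e * trace B) * A $ 1 $ 1 - (trace B + e * trace A) * B $ 1 $ 1
    - e * trace (B ** A) + (e\<^sup>2 + e * trace A * trace B + 1) = 0"
proof -
  have "A $ 1 $ 1 * A $ 2 $ 2 - A $ 1 $ 2 * A $ 2 $ 1 = 1"
    "B $ 1 $ 1 * B $ 2 $ 2 - B $ 1 $ 2 * B $ 2 $ 1 = 1"
    using assms(1,2) by (simp_all add: SL2_def det_2)
  then show ?thesis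
    unfolding assms(3)[symmetric] matrix_mult_2 trace_2 by algebra
qed

theorem corollary2p19:
  fixes \<theta>0 \<theta>1 \<theta>inf :: complex
    and C :: "((complex^2^2) \<times> (complex^2^2)) set"
    and M0 M1 N0 N1 :: "complex^2^2"
    and x0 x1 x2 y0 y1 y2 :: complex
  assumes "C \<in> monodromy_manifold \<theta>0 \<theta>1 \<theta>inf" and "(M0, M1) \<in> C"
    and "x0 = M0 $ 1 $ 1" and "x1 = M1 $ 1 $ 1" and "x2 = trace (M1 ** M0)"
    and "N0 = (M1 ** M0) ** M0 ** matrix_inv (M1 ** M0)"
    and "N1 = (M1 ** M0) ** M1 ** matrix_inv (M1 ** M0)"
    and "y0 = N0 $ 1 $ 1" and "y1 = N1 $ 1 $ 1" and "y2 = trace (N1 ** N0)"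
  shows "(y0, y1, y2) \<in> character_variety \<theta>0 \<theta>1 \<theta>inf
    \<and> y0 = - x1 * x2 - x0 + trace M0 + exp (- (of_real pi * \<i> * \<theta>inf)) * trace M1
    \<and> y1 = x1 * x2\<^sup>2 + x0 * x2 - x1
            - (trace M0 + exp (- (of_real pi * \<i> * \<theta>inf)) * trace M1) * x2
            + trace M1 + exp (- (of_real pi * \<i> * \<theta>inf)) * trace M0
    \<and> y2 = x2"
proof -
  define e where "e = exp (- (of_real pi * \<i> * \<theta>inf))"
  define P where "P = M1 ** M0"
  \<comment> \<open>A class is contained in the carrier of the equivalence relation, so every
    representative satisfies the defining equations.\<close>
  have "(M0, M1) \<in> monodromy_pairs \<theta>0 \<theta>1 \<theta>inf"
    using in_quotient_imp_subset[OF equiv_monodromy_rel] assms(1,2)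
    unfolding monodromy_manifold_def by blast
  then have SL: "M0 \<in> SL2" "M1 \<in> SL2"
    and P11: "P $ 1 $ 1 = e"
    and T: "trace M0 = 2 * cos (of_real pi * \<theta>0)" "trace M1 = 2 * cos (of_real pi * \<theta>1)"
    by (auto simp: monodromy_pairs_def P_def e_def matrix_mult_2 mult.commute)
  have inv: "invertible P"
    unfolding P_def by (intro invertible_SL2 SL2_mult SL)
  have trN: "trace N0 = trace M0" "trace N1 = trace M1"
    and SLN: "N0 \<in> SL2" "N1 \<in> SL2"
    using SL inv by (simp_all add: assms(6,7) SL2_def trace_conjugate det_conjugate flip: P_def)
  have NP: "N0 ** P = P ** M0" "N1 ** P = P ** M1"
    by (simp_all add: assms(6,7) conjugate_mult_right[OF inv] flip: P_def)
  have N0M1: "N0 ** M1 = P"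
  proof -
    \<comment> \<open>Since \<open>M1 ** M0 = P\<close>, the left side is
      \<open>N0 ** P\<close>.\<close>
    have "(N0 ** M1) ** M0 = P ** M0"
      using NP(1) by (simp add: P_def matrix_mul_assoc)
    then show ?thesis
      by (rule invertible_matrix_mult_right_cancel[OF invertible_SL2[OF SL(1)]])
  qed
  have N1N0: "N1 ** N0 = P"
  proof -
    \<comment> \<open>By \<open>N0M1\<close> the left side is \<open>N1 ** P\<close>.\<close>
    have "(N1 ** N0) ** M1 = P ** M1"
      by (metis N0M1 NP(2) matrix_mul_assoc)
    then show ?thesis
      by (rule invertible_matrix_mult_right_cancel[OF invertible_SL2[OF SL(2)]])
  qed
  have y0: "y0 = - x1 * x2 - x0 + trace M0 + e * trace M1"
    using SL2_conjugate_entry[of M1 N0 M0] SL(2) N0M1 P11 by (simp add: assms P_def)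
  \<comment> \<open>Second move: \<open>M1\<close> is conjugated by \<open>N0\<close>, and
    \<open>N1 ** N0 = N0 ** M1 = P\<close> keeps the corner \<open>e\<close> and the trace
    \<open>x2\<close>.\<close>
  have "y1 = - y0 * x2 - x1 + trace M1 + e * trace M0"
    using SL2_conjugate_entry[of N0 N1 M1] SLN(1) N0M1 N1N0 P11 trN
    by (simp add: assms(4,5,8,9) P_def)
  then have y1: "y1 = x1 * x2\<^sup>2 + x0 * x2 - x1 - (trace M0 + e * trace M1) * x2
      + trace M1 + e * trace M0"
    unfolding y0 by algebra
  have "exp (- (2 * of_real pi * \<i> * \<theta>inf)) = e\<^sup>2"
    by (simp add: e_def mult.assoc flip: exp_double)
  \<comment> \<open>The coefficients depend only on \<open>e\<close> and the two traces, which
    \<open>(N0, N1)\<close> shares with \<open>(M0, M1)\<close>.\<close>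
  then have "(y0, y1, y2) \<in> character_variety \<theta>0 \<theta>1 \<theta>inf"
    using SL2_character_equation[OF SLN, of e] N1N0 P11
    by (simp add: character_variety_def Let_def assms(8-10) trN T flip: e_def)
  moreover have "y2 = x2"
    by (simp add: assms(5,10) N1N0 P_def)
  ultimately show ?thesis
    using y0 y1 by (simp add: e_def)
qed

end
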